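(* Let $K$ be a convex body in $\mathbb{R}^3$ such that for every plane $P \subset \mathbb{R}^3$ the orthogonal projection $\pi_P(K)$ of $K$ into $P$ is a polygon. Then $K$ is a polyhedron.
   Context: A convex body in $\mathbb{R}^3$ is a closed bounded convex subset of $\mathbb{R}^3$ with nonempty interior. For a plane $P$ (a 2-dimensional affine subspace), $\pi_P(X)$ denotes the image of $X$ under orthogonal projection onto $P$. Saying that a compact convex subset of a plane (respectively of $\mathbb{R}^3$) is a polygon (respectively a polyhedron) means that it is the convex hull of finitely many points, equivalently a bounded intersection of finitely many closed half-planes (respectively closed half-spaces). *)

theory Defs
  imports "HOL-Analysis.Analysis"
begin

definition convex_body :: "'a::euclidean_space set \<Rightarrow> bool" where
  "convex_body K \<longleftrightarrow> closed K \<and> bounded K \<and> convex K \<and> interior K \<noteq> {}"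

definition plane :: "'a::euclidean_space set \<Rightarrow> bool" where
  "plane P \<longleftrightarrow> affine P \<and> aff_dim P = 2"

(* Meaningful for nonempty affine P, where the foot of the perpendicular exists uniquely
   (lemma orth_proj_ex1). *)
definition orth_proj :: "'a::euclidean_space set \<Rightarrow> 'a \<Rightarrow> 'a" where
  "orth_proj P x = (THE y. y \<in> P \<and> (\<forall>z\<in>P. orthogonal (x - y) (z - y)))"

lemma orth_proj_ex1:
  fixes P :: "'a::euclidean_space set"
  assumes "affine P" and "P \<noteq> {}"
  shows "\<exists>!y. y \<in> P \<and> (\<forall>z\<in>P. orthogonal (x - y) (z - y))"
proof (rule ex_ex1I)
  obtain a where a: "a \<in> P"
    using assms(2) by blast
  define S where "S = (\<lambda>z. z - a) ` P"
  have S: "subspace S"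
    unfolding S_def using affine_diffs_subspace_subtract[OF assms(1) a] by simp
  obtain u v where u: "u \<in> span S" and v: "\<And>w. w \<in> span S \<Longrightarrow> orthogonal v w"
    and uv: "x - a = u + v"
    using orthogonal_subspace_decomp_exists[of S "x - a"] by metis
  have sp: "span S = S"
    using S by (simp add: span_eq_iff)
  have "u \<in> S"
    using u sp by simp
  then have "a + u \<in> P"
    by (auto simp: S_def)
  moreover have "orthogonal (x - (a + u)) (z - (a + u))" if "z \<in> P" for z
  proof -
    have "z - a \<in> S"
      using that by (simp add: S_def)
    then have "(z - a) - u \<in> span S"
      using u sp S subspace_diff by blast
    then have "orthogonal v ((z - a) - u)"
      by (rule v)
    moreover have "x - (a + u) = v"
      using uv by (simp add: algebra_simps)
    ultimately show ?thesis
      by (simp add: algebra_simps)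
  qed
  ultimately show "\<exists>y. y \<in> P \<and> (\<forall>z\<in>P. orthogonal (x - y) (z - y))"
    by blast
next
  fix y y'
  assume y: "y \<in> P \<and> (\<forall>z\<in>P. orthogonal (x - y) (z - y))"
    and y': "y' \<in> P \<and> (\<forall>z\<in>P. orthogonal (x - y') (z - y'))"
  then have "(x - y) \<bullet> (y' - y) = 0" "(x - y') \<bullet> (y - y') = 0"
    by (auto simp: orthogonal_def)
  then have "(y' - y) \<bullet> (y' - y) = 0"
    by (simp add: inner_diff_left inner_diff_right inner_commute)
  then show "y = y'"
    by simp
qed

end

theory Submission
  imports Defs
begin

text \<open>
  The proof works with the faces \<open>support_face K w\<close> of maximisers of the linear functional
  \<open>x \<bullet> w\<close> on \<open>K\<close>, and so, implicitly, with the support function of \<open>K\<close>. The body is a polytope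
  as soon as finitely many of its points meet the faces in all directions: a point of \<open>K\<close> outside
  their convex hull could be separated from them, in a direction where one of them is maximal.

  A functional with direction in a plane \<open>P\<close> through the origin takes the same values on \<open>K\<close> and
  on its projection into \<open>P\<close>. If this projection is a polygon, one vertex of it remains maximal
  when a direction \<open>v\<close> is moved a little way towards \<open>v + d\<close>. Hence for all \<open>v\<close> and \<open>d\<close> the faces
  in directions \<open>v\<close> and \<open>v + b *\<^sub>R d\<close> share a point for some \<open>b > 0\<close>
  (\<open>polygonal_projections_directionally_polyhedral\<close>). Here \<open>b\<close> depends on \<open>d\<close>, and the question
  is how to reach every direction near \<open>v\<close> with finitely many points.

  The crucial observation is \<open>support_face_segment_interior\<close>: if the faces at both ends of a
  segment of directions share a point, then the face at an interior direction \<open>v'\<close> of the segment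
  lies in the face of \<open>v\<close>. So points that serve all directions \<open>v' + u\<close>, with \<open>u\<close> small and
  orthogonal to \<open>d\<close>, are maximal for \<open>v\<close> too if they are maximal for \<open>v'\<close>, and then they serve
  the whole cone with apex \<open>v\<close> over these directions, a full sector around \<open>d\<close>. The directions \<open>u\<close>
  range over a space of smaller dimension, which allows induction, and by compactness of the unit
  sphere finitely many sectors fill a neighbourhood of \<open>v\<close> (\<open>finite_support_near\<close>). For \<open>v = 0\<close>
  such a neighbourhood contains a positive multiple of every direction. The argument applies in
  every dimension at least two.
\<close>

section \<open>Support faces\<close>

definition support_face :: "'a::euclidean_space set \<Rightarrow> 'a \<Rightarrow> 'a set" where
  "support_face K w = {x \<in> K. \<forall>y\<in>K. y \<bullet> w \<le> x \<bullet> w}"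

lemma support_faceI:
  assumes "x \<in> K" "\<And>y. y \<in> K \<Longrightarrow> y \<bullet> w \<le> x \<bullet> w"
  shows "x \<in> support_face K w"
  using assms by (simp add: support_face_def)

lemma support_face_subset: "support_face K w \<subseteq> K"
  by (auto simp: support_face_def)

lemma support_faceD: "x \<in> support_face K w \<Longrightarrow> y \<in> K \<Longrightarrow> y \<bullet> w \<le> x \<bullet> w"
  by (auto simp: support_face_def)

lemma support_face_zero [simp]: "support_face K 0 = K"
  by (auto simp: support_face_def)

lemma support_face_nonempty:
  assumes "compact K" "K \<noteq> {}"
  shows "support_face K w \<noteq> {}"
proof -
  have "continuous_on K (\<lambda>x. x \<bullet> w)"
    by (intro continuous_intros)
  from continuous_attains_sup[OF assms this] show ?thesis
    by (auto simp: support_face_def)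
qed

lemma support_face_cone:
  assumes "x \<in> support_face K v" "x \<in> support_face K w" "0 \<le> a" "0 \<le> b"
  shows "x \<in> support_face K (a *\<^sub>R v + b *\<^sub>R w)"
  using assms by (auto simp: support_face_def inner_add_right intro!: add_mono mult_left_mono)

text \<open>
  A point shared by the faces at both ends of the segment is maximal along all of it, so on the
  segment the support function is affine. A point that touches an affine function from below in
  the interior of a segment agrees with it up to the ends.
\<close>

lemma support_face_segment_interior:
  assumes x0: "x0 \<in> support_face K v" "x0 \<in> support_face K (v + e *\<^sub>R d)"
    and c: "0 < c" "c < e"
    and x: "x \<in> support_face K (v + c *\<^sub>R d)"
  shows "x \<in> support_face K v"
proof -
  have K: "x \<in> K" "x0 \<in> K"
    using x x0 support_face_subset by blast+
  \<comment> \<open>The values at \<open>x\<close> and \<open>x0\<close> in direction \<open>v + t *\<^sub>R d\<close> differ by \<open>p + t * q\<close>.\<close>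
  define p q where "p = (x - x0) \<bullet> v" and "q = (x - x0) \<bullet> d"
  have "p + e * q \<le> 0"
    using support_faceD[OF x0(2) K(1)] by (simp add: p_def q_def inner_simps algebra_simps)
  moreover have cq: "0 \<le> p + c * q"
    using support_faceD[OF x K(2)] by (simp add: p_def q_def inner_simps algebra_simps)
  ultimately have "(e - c) * q \<le> 0"
    by (simp add: algebra_simps)
  then have "q \<le> 0"
    using c by (simp add: mult_le_0_iff)
  then have "c * q \<le> 0"
    using c by (simp add: mult_le_0_iff)
  then have "x0 \<bullet> v \<le> x \<bullet> v"
    using cq by (simp add: p_def inner_simps)
  then show ?thesis
    using support_faceD[OF x0(1)] K by (intro support_faceI) force+
qed

section \<open>Finitely many points maximal in all directions\<close>

text \<open>
  Equivalently for nonempty compact \<open>K\<close>: the support function is affine on an initial piece of every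
  ray. The length of the piece need not be bounded below near a given starting point.
\<close>

definition directionally_polyhedral :: "'a::euclidean_space set \<Rightarrow> bool" where
  "directionally_polyhedral K \<longleftrightarrow>
     (\<forall>v d. \<exists>b>0. support_face K v \<inter> support_face K (v + b *\<^sub>R d) \<noteq> {})"

text \<open>
  The inclusion \<open>S \<subseteq> support_face K v\<close> is what makes the induction work: it turns a finite set for
  directions near \<open>v'\<close> into one for the cone over them with apex \<open>v\<close>. The restriction to a
  subspace \<open>V\<close> provides the dimension on which to induct.
\<close>

lemma finite_support_near:
  fixes K V :: "'a::euclidean_space set"
  assumes K: "directionally_polyhedral K" and "subspace V"
  shows "\<exists>S r. finite S \<and> S \<subseteq> support_face K v \<and> 0 < r \<and>
           (\<forall>u\<in>V. norm u < r \<longrightarrow> S \<inter> support_face K (v + u) \<noteq> {})"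
  using \<open>subspace V\<close>
proof (induction "dim V" arbitrary: V v rule: less_induct)
  case less
  note V = \<open>subspace V\<close>
  obtain x1 where x1: "x1 \<in> support_face K v"
    using K unfolding directionally_polyhedral_def by blast
  define C where "C = sphere 0 1 \<inter> V"
  have "compact C"
    unfolding C_def using V by (intro compact_Int_closed closed_subspace) auto
  have "\<forall>d\<in>C. \<exists>S c Z. finite S \<and> S \<subseteq> support_face K v \<and> 0 < c \<and> open Z \<and> d \<in> Z \<and>
      (\<forall>z\<in>Z \<inter> C. \<forall>t. 0 \<le> t \<and> t \<le> c \<longrightarrow> S \<inter> support_face K (v + t *\<^sub>R z) \<noteq> {})"
  proof
    fix d assume "d \<in> C"
    have d: "norm d = 1" "d \<in> V" "d \<bullet> d = 1"
      using \<open>d \<in> C\<close> by (auto simp: C_def dot_square_norm)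
    obtain e x0 where e: "0 < e" and x0: "x0 \<in> support_face K v" "x0 \<in> support_face K (v + e *\<^sub>R d)"
      using K unfolding directionally_polyhedral_def by blast
    define c where "c = e / 2"
    have c: "0 < c" "c < e"
      using e by (auto simp: c_def)
    define W where "W = {u \<in> V. d \<bullet> u = 0}"
    have "subspace W"
      using V unfolding W_def subspace_def by (auto simp: inner_simps)
    moreover have "dim W < dim V"
    proof (rule dim_psubset)
      have "d \<notin> W"
        using d by (simp add: W_def)
      moreover have "W \<subseteq> V"
        by (auto simp: W_def)
      ultimately show "span W \<subset> span V"
        using \<open>subspace W\<close> V d by (auto simp: span_eq_iff[THEN iffD2])
    qed
    ultimately obtain S r where S: "finite S" "S \<subseteq> support_face K (v + c *\<^sub>R d)" and r: "0 < r"
      and near: "\<And>u. u \<in> W \<Longrightarrow> norm u < r \<Longrightarrow> S \<inter> support_face K (v + c *\<^sub>R d + u) \<noteq> {}"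
      using less.hyps[of W "v + c *\<^sub>R d"] by metis
    have Sv: "S \<subseteq> support_face K v"
      using S(2) support_face_segment_interior[OF x0 c] by blast
    \<comment> \<open>A vector \<open>z \<in> V\<close> is taken into the open cone \<open>Z\<close> around \<open>d\<close> if the ray from \<open>v\<close> in direction
      \<open>z\<close> passes through the ball of radius \<open>r\<close> around \<open>v + c *\<^sub>R d\<close> within the translate of \<open>W\<close>,
      the orthogonal complement of \<open>d\<close> in \<open>V\<close>, through this point.\<close>
    define Z where "Z = {z. 0 < d \<bullet> z} \<inter> {z. c * norm (z - (d \<bullet> z) *\<^sub>R d) < r * (d \<bullet> z)}"
    have "open Z"
      unfolding Z_def by (intro open_Int open_Collect_less continuous_intros)
    moreover have "d \<in> Z"
      using d r by (simp add: Z_def)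
    moreover have "S \<inter> support_face K (v + t *\<^sub>R z) \<noteq> {}"
      if z: "z \<in> Z" "z \<in> C" and t: "0 \<le> t" "t \<le> c" for z t
    proof -
      define m where "m = d \<bullet> z"
      define u where "u = (c / m) *\<^sub>R (z - m *\<^sub>R d)"
      have zV: "z \<in> V" "norm z = 1"
        using z by (auto simp: C_def)
      have m: "0 < m" "c * norm (z - m *\<^sub>R d) < r * m"
        using z by (auto simp: Z_def m_def)
      have "m \<le> 1"
        using norm_cauchy_schwarz[of d z] d zV by (simp add: m_def)
      have "u \<in> W"
        using V zV d by (auto simp: W_def u_def m_def inner_simps intro!: subspace_scale subspace_diff)
      moreover have "norm u < r"
        using m c unfolding u_def norm_scaleR by (simp add: pos_divide_less_eq)
      ultimately obtain x where x: "x \<in> S" "x \<in> support_face K (v + c *\<^sub>R d + u)"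
        using near by blast
      \<comment> \<open>The point \<open>v + t *\<^sub>R z\<close> divides the segment from \<open>v\<close> to \<open>v + c *\<^sub>R d + u\<close> in ratio \<open>l\<close>;
        since \<open>m \<le> 1\<close>, it does not lie beyond the far end.\<close>
      define l where "l = t * m / c"
      have "t * m \<le> c * 1"
        using t m c \<open>m \<le> 1\<close> by (intro mult_mono) auto
      then have l: "0 \<le> l" "l \<le> 1"
        using t m c by (auto simp: l_def)
      have "x \<in> support_face K ((1 - l) *\<^sub>R v + l *\<^sub>R (v + c *\<^sub>R d + u))"
        using x Sv l by (intro support_face_cone) auto
      moreover have "(1 - l) *\<^sub>R v + l *\<^sub>R (v + c *\<^sub>R d + u) = v + t *\<^sub>R z"
      proof -
        have "c * l = m * t" "l *\<^sub>R u = t *\<^sub>R (z - m *\<^sub>R d)"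
          using m c by (simp_all add: l_def u_def)
        then show ?thesis
          by (simp add: algebra_simps)
      qed
      ultimately show ?thesis
        using x by auto
    qed
    ultimately show "\<exists>S c Z. finite S \<and> S \<subseteq> support_face K v \<and> 0 < c \<and> open Z \<and> d \<in> Z \<and>
        (\<forall>z\<in>Z \<inter> C. \<forall>t. 0 \<le> t \<and> t \<le> c \<longrightarrow> S \<inter> support_face K (v + t *\<^sub>R z) \<noteq> {})"
      using S(1) Sv c(1) by (intro exI[of _ S] exI[of _ c] exI[of _ Z]) auto
  qed
  then obtain S c Z where fin: "\<And>d. d \<in> C \<Longrightarrow> finite (S d)"
    and Sv: "\<And>d. d \<in> C \<Longrightarrow> S d \<subseteq> support_face K v"
    and c: "\<And>d. d \<in> C \<Longrightarrow> 0 < (c d :: real)"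
    and Z: "\<And>d. d \<in> C \<Longrightarrow> open (Z d)" "\<And>d. d \<in> C \<Longrightarrow> d \<in> Z d"
    and hit: "\<And>d z t. d \<in> C \<Longrightarrow> z \<in> Z d \<Longrightarrow> z \<in> C \<Longrightarrow> 0 \<le> t \<Longrightarrow> t \<le> c d \<Longrightarrow>
                S d \<inter> support_face K (v + t *\<^sub>R z) \<noteq> {}"
    unfolding bchoice_iff by fast
  have "C \<subseteq> (\<Union>d\<in>C. Z d)"
    using Z(2) by blast
  then obtain D where D: "D \<subseteq> C" "finite D" "C \<subseteq> (\<Union>d\<in>D. Z d)"
    using compactE_image[OF \<open>compact C\<close>, of C Z] Z(1) by metis
  \<comment> \<open>Inserting \<open>1\<close> and \<open>x1\<close> covers \<open>V = {0}\<close>, where \<open>D\<close> is empty, and the direction \<open>v\<close> itself.\<close>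
  define r where "r = Min (insert 1 (c ` D))"
  define T where "T = insert x1 (\<Union>d\<in>D. S d)"
  have "finite T"
    using D fin by (auto simp: T_def)
  moreover have "T \<subseteq> support_face K v"
    using D(1) Sv x1 unfolding T_def by blast
  moreover have "0 < r"
    using D c by (auto simp: r_def)
  moreover have "T \<inter> support_face K (v + u) \<noteq> {}" if u: "u \<in> V" "norm u < r" for u
  proof (cases "u = 0")
    case True
    then show ?thesis
      using x1 by (auto simp: T_def)
  next
    case False
    define z where "z = u /\<^sub>R norm u"
    have z: "z \<in> C" "u = norm u *\<^sub>R z"
      using False u V by (auto simp: z_def C_def intro: subspace_scale)
    obtain d where d: "d \<in> D" "z \<in> Z d"
      using z D by blast
    have "r \<le> c d"
      using d D by (auto simp: r_def)
    then have "S d \<inter> support_face K (v + norm u *\<^sub>R z) \<noteq> {}"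
      using d D u z by (intro hit) auto
    then show ?thesis
      using d z(2) by (auto simp: T_def)
  qed
  ultimately show ?case
    by blast
qed

lemma directionally_polyhedral_imp_polytope:
  fixes K :: "'a::euclidean_space set"
  assumes K: "directionally_polyhedral K" and "convex K"
  shows "polytope K"
proof -
  obtain S r where S: "finite S" "S \<subseteq> K" and r: "0 < (r::real)"
    and near: "\<And>u. norm u < r \<Longrightarrow> S \<inter> support_face K u \<noteq> {}"
    using finite_support_near[OF K subspace_UNIV, of 0] by auto
  have "y \<in> convex hull S" if y: "y \<in> K" for y
  proof (rule ccontr)
    assume "y \<notin> convex hull S"
    then obtain a b where a: "a \<bullet> y < b" and b: "\<And>x. x \<in> convex hull S \<Longrightarrow> b < a \<bullet> x"
      using separating_hyperplane_closed_point[of "convex hull S" y] S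
      by (metis convex_convex_hull compact_imp_closed finite_imp_compact_convex_hull)
    \<comment> \<open>Any positive factor that brings \<open>a\<close> into the ball of radius \<open>r\<close> would do.\<close>
    define k where "k = r / (1 + norm a)"
    have k: "0 < k"
      using r by (auto simp: k_def intro!: divide_pos_pos add_pos_nonneg)
    have "norm (- k *\<^sub>R a) < r"
      using r by (simp add: k_def field_simps add_pos_nonneg abs_of_nonneg)
    then obtain x where x: "x \<in> S" "x \<in> support_face K (- k *\<^sub>R a)"
      using near by blast
    have "a \<bullet> y < a \<bullet> x"
      using a b[of x] x hull_inc[of x S convex] by force
    moreover have "k * (a \<bullet> x) \<le> k * (a \<bullet> y)"
      using support_faceD[OF x(2) y] by (simp add: inner_commute)
    ultimately show False
      using k by simp
  qed
  moreover have "convex hull S \<subseteq> K"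
    using S \<open>convex K\<close> by (simp add: hull_minimal)
  ultimately show ?thesis
    using S(1) unfolding polytope_def by blast
qed

section \<open>Polygonal projections\<close>

text \<open>
  In every direction some vertex is maximal. As there are finitely many of them, a single vertex is
  maximal for arbitrarily small \<open>t > 0\<close> in direction \<open>v + t *\<^sub>R d\<close>, and then by continuity for \<open>v\<close>.
\<close>

lemma polytope_directionally_polyhedral:
  fixes Q :: "'a::euclidean_space set"
  assumes "polytope Q" "Q \<noteq> {}"
  shows "directionally_polyhedral Q"
  unfolding directionally_polyhedral_def
proof (intro allI)
  fix v d
  obtain S where S: "finite S" "Q = convex hull S"
    using assms by (auto simp: polytope_def)
  have SQ: "S \<subseteq> Q"
    by (simp add: S(2) hull_subset)
  have attain: "\<exists>s\<in>S. s \<in> support_face Q w" for w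
  proof -
    have "S \<noteq> {}"
      using assms(2) S(2) by auto
    then obtain s where s: "s \<in> support_face S w"
      using support_face_nonempty[of S w] S(1) finite_imp_compact by blast
    have "Q \<subseteq> {y. w \<bullet> y \<le> w \<bullet> s}"
      unfolding S(2) using s
      by (intro hull_minimal convex_halfspace_le) (auto simp: support_face_def inner_commute)
    then show ?thesis
      using s SQ by (auto simp: support_face_def inner_commute intro!: bexI[of _ s])
  qed
  have "\<exists>\<^sub>F t in at_right (0::real). \<exists>s\<in>S. s \<in> support_face Q (v + t *\<^sub>R d)"
    using attain by (intro eventually_frequently) auto
  from frequently_bex_finite[OF S(1) this] obtain s where s: "s \<in> S"
    and freq: "\<exists>\<^sub>F t in at_right (0::real). s \<in> support_face Q (v + t *\<^sub>R d)"
    by blast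
  have "y \<bullet> v \<le> s \<bullet> v" if y: "y \<in> Q" for y
  proof (rule ccontr)
    assume "\<not> y \<bullet> v \<le> s \<bullet> v"
    moreover have "((\<lambda>t. (y - s) \<bullet> (v + t *\<^sub>R d)) \<longlongrightarrow> (y - s) \<bullet> (v + 0 *\<^sub>R d)) (at_right 0)"
      by (intro tendsto_intros)
    ultimately have "\<forall>\<^sub>F t in at_right 0. 0 < (y - s) \<bullet> (v + t *\<^sub>R d)"
      by (intro order_tendstoD(1)) (auto simp: inner_simps)
    with freq have "\<exists>\<^sub>F t in at_right 0. s \<in> support_face Q (v + t *\<^sub>R d) \<and> 0 < (y - s) \<bullet> (v + t *\<^sub>R d)"
      by (rule frequently_eventually_frequently)
    then obtain t where "s \<in> support_face Q (v + t *\<^sub>R d)" "0 < (y - s) \<bullet> (v + t *\<^sub>R d)"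
      using frequently_ex by blast
    then show False
      using support_faceD[OF _ y] by (force simp: inner_diff_left)
  qed
  then have "s \<in> support_face Q v"
    using s SQ by (auto intro: support_faceI)
  moreover obtain b where "0 < b" "s \<in> support_face Q (v + b *\<^sub>R d)"
    using frequently_ex[OF frequently_eventually_frequently[OF freq eventually_at_right_less]]
    by auto
  ultimately show "\<exists>b>0. support_face Q v \<inter> support_face Q (v + b *\<^sub>R d) \<noteq> {}"
    by blast
qed

lemma inner_orth_proj:
  fixes P :: "'a::euclidean_space set"
  assumes "subspace P"
    and w: "w \<in> P"
  shows "orth_proj P x \<bullet> w = x \<bullet> w"
proof -
  have "affine P" "P \<noteq> {}"
    using assms subspace_imp_affine subspace_0 by blast+
  from theI'[OF orth_proj_ex1[OF this, of x]]
  have *: "orth_proj P x \<in> P" "\<And>z. z \<in> P \<Longrightarrow> orthogonal (x - orth_proj P x) (z - orth_proj P x)"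
    unfolding orth_proj_def by blast+
  have "orthogonal (x - orth_proj P x) (orth_proj P x + w - orth_proj P x)"
    using * w assms by (intro *(2) subspace_add)
  then show "orth_proj P x \<bullet> w = x \<bullet> w"
    by (simp add: orthogonal_def inner_diff_left)
qed

text \<open>
  The vectors may be linearly dependent, so a basis of their span is extended to two elements.
\<close>

lemma plane_through_two_vectors:
  fixes v d :: "'a::euclidean_space"
  assumes "2 \<le> DIM('a)"
  obtains P where "subspace P" "plane P" "v \<in> P" "d \<in> P"
proof -
  obtain B where B: "B \<subseteq> {v, d}" "independent B" "{v, d} \<subseteq> span B"
    using maximal_independent_subset by blast
  obtain C where C: "B \<subseteq> C" "independent C" "UNIV \<subseteq> span C"
    using maximal_independent_subset_extend[of B UNIV] B(2) by auto
  have "finite C" "card C = DIM('a)"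
    using C independent_imp_finite basis_card_eq_dim[of C UNIV] by (auto simp: dim_UNIV)
  moreover have "card B \<le> 2"
    using card_mono[OF _ B(1)] card_insert_le_m1[of 2 "{d}" v] by auto
  ultimately obtain E where E: "B \<subseteq> E" "E \<subseteq> C" "card E = 2"
    using exists_subset_between[of B 2 C] C(1) assms by auto
  have "independent E"
    using C(2) E(2) independent_mono by blast
  then have "dim (span E) = 2"
    using E(3) by (simp add: dim_eq_card_independent)
  then have "plane (span E)"
    unfolding plane_def by (simp add: subspace_imp_affine aff_dim_subspace)
  then show ?thesis
    using that[of "span E"] B(3) span_mono[OF E(1)] by auto
qed

lemma polygonal_projections_directionally_polyhedral:
  fixes K :: "'a::euclidean_space set"
  assumes "2 \<le> DIM('a)" "K \<noteq> {}"
    and poly: "\<And>P. plane P \<Longrightarrow> polytope (orth_proj P ` K)"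
  shows "directionally_polyhedral K"
  unfolding directionally_polyhedral_def
proof (intro allI)
  fix v d :: 'a
  obtain P where P: "subspace P" "plane P" "v \<in> P" "d \<in> P"
    using plane_through_two_vectors[OF assms(1)] by blast
  have lift: "x \<in> support_face K w"
    if "x \<in> K" "orth_proj P x \<in> support_face (orth_proj P ` K) w" "w \<in> P" for x w
    using that inner_orth_proj[OF P(1)] by (auto simp: support_face_def)
  obtain b y where b: "0 < b" and y: "y \<in> support_face (orth_proj P ` K) v"
      "y \<in> support_face (orth_proj P ` K) (v + b *\<^sub>R d)"
    using polytope_directionally_polyhedral[OF poly[OF P(2)]] assms(2)
    unfolding directionally_polyhedral_def by blast
  obtain x where "x \<in> K" "y = orth_proj P x"
    using y(1) support_face_subset by blast
  then have "x \<in> support_face K v" "x \<in> support_face K (v + b *\<^sub>R d)"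
    using lift y P by (auto intro: subspace_add subspace_scale)
  then show "\<exists>b>0. support_face K v \<inter> support_face K (v + b *\<^sub>R d) \<noteq> {}"
    using b by blast
qed

theorem theorem1p5:
  fixes K :: "(real ^ 3) set"
  assumes "convex_body K"
    and "\<And>P. plane P \<Longrightarrow> polytope (orth_proj P ` K)"
  shows "polytope K"
proof (rule directionally_polyhedral_imp_polytope)
  have "K \<noteq> {}"
    using assms(1) by (auto simp: convex_body_def)
  then show "directionally_polyhedral K"
    using assms(2) by (intro polygonal_projections_directionally_polyhedral) auto
  show "convex K"
    using assms(1) by (simp add: convex_body_def)
qed

end
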